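(* Let $a,b$ be positive real numbers with $a\neq b$, let $n\geq 0$ be an integer, and let $\alpha,\lambda\in\mathbb{C}$. Then $$G_{n}^{(\alpha)}(a,b;\lambda)=G_{n}^{(\alpha)}\Big(\frac{\alpha\ln a}{\ln a-\ln b};\lambda\Big)(\ln b-\ln a)^{n-\alpha}.$$
   Context: The generalized Apostol-Genocchi numbers of order $\alpha$ with parameters $a,b$ are defined by $\Big(\frac{2t}{\lambda b^{t}+a^{t}}\Big)^{\alpha}=\sum_{n\ge0}G_{n}^{(\alpha)}(a,b;\lambda)\frac{t^{n}}{n!}$. The Apostol-Genocchi polynomials of order $\alpha$ are defined by $\Big(\frac{2z}{\lambda e^{z}+1}\Big)^{\alpha}e^{xz}=\sum_{n\ge0}G_{n}^{(\alpha)}(x;\lambda)\frac{z^{n}}{n!}$. *)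

theory Defs
  imports "HOL-Complex_Analysis.Complex_Analysis"
begin

(* The identity "f t = (\<Sum>n. G n * t ^ n / n!)" between a function and an exponential generating
   series, near t = 0.  A power series is determined by its values at small real t \<noteq> 0, and the
   generating functions below involve a complex power, so t is taken to be real: their base
   may tend to a negative real number as t tends to 0, and the principal power is discontinuous on
   complex neighbourhoods of such a number, whereas for real t the base stays on the real axis.
   The point t = 0 is excluded because the quotients below are, as they stand, of the form 0 / 0
   or 0 / (lam + 1) there. *)
definition has_egf :: "(real \<Rightarrow> complex) \<Rightarrow> (nat \<Rightarrow> complex) \<Rightarrow> bool" where
  "has_egf f G \<longleftrightarrow>
     (\<forall>\<^sub>F t in at 0. (\<lambda>n. G n * of_real t ^ n / fact n) sums f t)"

(* G n for the sequence G with has_egf f G, which is unique by has_egf_unique below.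
   A function that has no expansion in nonnegative integer powers of t has no such numbers;
   the value 0 is then a mere convention. *)
definition egf_coeff :: "(real \<Rightarrow> complex) \<Rightarrow> nat \<Rightarrow> complex" where
  "egf_coeff f n = (if \<exists>G. has_egf f G then (THE G. has_egf f G) n else 0)"

(* G_n^(\<alpha>)(a, b; lam) *)
definition apostol_genocchi_number ::
    "complex \<Rightarrow> real \<Rightarrow> real \<Rightarrow> complex \<Rightarrow> nat \<Rightarrow> complex" where
  "apostol_genocchi_number \<alpha> a b lam n =
     egf_coeff (\<lambda>t. (2 * of_real t / (lam * of_real (b powr t) + of_real (a powr t))) powr \<alpha>) n"

(* G_n^(\<alpha>)(x; lam) *)
definition apostol_genocchi_poly ::
    "complex \<Rightarrow> complex \<Rightarrow> complex \<Rightarrow> nat \<Rightarrow> complex" where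
  "apostol_genocchi_poly \<alpha> x lam n =
     egf_coeff (\<lambda>z. (2 * of_real z / (lam * exp (of_real z) + 1)) powr \<alpha> * exp (x * of_real z)) n"

lemma has_egf_unique:
  assumes "has_egf f G" and "has_egf f H"
  shows "G = H"
proof (rule ccontr)
  define d where "d n = (G n - H n) / fact n" for n
  assume "G \<noteq> H"
  then obtain k where k: "d k \<noteq> 0" by (auto simp: d_def)
  have ev: "\<forall>\<^sub>F t in at (0::real). (\<lambda>n. d n * of_real t ^ n) sums 0"
    using assms unfolding has_egf_def
  proof eventually_elim
    case (elim t)
    show ?case using sums_diff[OF elim] by (simp add: d_def diff_divide_distrib algebra_simps)
  qed
  then obtain e where e: "e > 0" "\<And>t::real. t \<noteq> 0 \<Longrightarrow> \<bar>t\<bar> < e \<Longrightarrow> (\<lambda>n. d n * of_real t ^ n) sums 0"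
    unfolding eventually_at by (auto simp: dist_real_def)
  define F where "F z = (\<Sum>n. d n * z ^ n)" for z :: complex
  have sm: "(\<lambda>n. d n * z ^ n) sums F z" if z: "norm z < e/2" for z
  proof -
    have "summable (\<lambda>n. d n * (of_real (e/2)) ^ n)"
      using e(2)[of "e/2"] e(1) by (auto simp: sums_iff)
    then have "summable (\<lambda>n. d n * z ^ n)"
      by (rule powser_inside) (use z e(1) in auto)
    then show ?thesis by (simp add: F_def summable_sums)
  qed
  have F0: "F (of_real t) = 0" if "t \<noteq> 0" "\<bar>t\<bar> < e" for t
    using e(2)[OF that] by (simp add: F_def sums_iff)
  have hol: "F holomorphic_on ball 0 (e/2)"
    by (rule power_series_holomorphic[where a = d]) (use sm in auto)
  have Fz: "F z = 0" if "z \<in> ball 0 (e/2)" for z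
  proof (rule analytic_continuation[of F "ball 0 (e/2)" "of_real ` {0<..<e/2}" 0])
    show "(0::complex) islimpt of_real ` {0<..<e/2}"
      unfolding islimpt_approachable
    proof (intro allI impI)
      fix r :: real assume "r > 0"
      then show "\<exists>y\<in>of_real ` {0<..<e/2}. y \<noteq> 0 \<and> dist y (0::complex) < r"
        using e(1) by (intro bexI[of _ "of_real (min r (e/2) / 2)"] imageI) (auto simp: min_def)
    qed
  qed (use hol that e(1) F0 in auto)
  have "d n = 0" for n
  proof -
    have "F has_fps_expansion Abs_fps d"
    proof (rule has_fps_expansionI)
      have "\<forall>\<^sub>F u in nhds 0. u \<in> ball (0::complex) (e/2)"
        by (rule eventually_nhds_in_open) (use e(1) in auto)
      then show "\<forall>\<^sub>F u in nhds 0. (\<lambda>n. fps_nth (Abs_fps d) n * u ^ n) sums F u"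
        by eventually_elim (use sm in auto)
    qed
    moreover have "F has_fps_expansion 0"
    proof -
      have "\<forall>\<^sub>F u in nhds 0. u \<in> ball (0::complex) (e/2)"
        by (rule eventually_nhds_in_open) (use e(1) in auto)
      then have "\<forall>\<^sub>F u in nhds 0. F u = 0"
        by eventually_elim (use Fz in auto)
      then show ?thesis
        by (subst has_fps_expansion_cong[where g = "\<lambda>_. 0"]) auto
    qed
    ultimately have "Abs_fps d = 0" using fps_expansion_unique_complex by blast
    then show ?thesis by (metis fps_nth_Abs_fps fps_zero_nth)
  qed
  with k show False by simp
qed

lemma egf_coeff_eq: "has_egf f G \<Longrightarrow> egf_coeff f = G"
proof -
  assume G: "has_egf f G"
  then have "(THE G. has_egf f G) = G" using has_egf_unique by (intro the_equality) blast+
  with G show ?thesis unfolding egf_coeff_def by (intro ext) auto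
qed

lemma has_egf_analytic:
  assumes "g analytic_on {0}" and "\<forall>\<^sub>F t in at 0. f t = g (complex_of_real t)"
  shows "has_egf f (\<lambda>n. (deriv ^^ n) g 0)"
proof -
  obtain r where r: "r > 0" "g holomorphic_on ball 0 r"
    using assms(1) by (auto simp: analytic_at_ball)
  have "\<forall>\<^sub>F t in at 0. t \<in> ball (0::real) r"
    using r(1) by (intro eventually_at_in_open') auto
  with assms(2) show ?thesis unfolding has_egf_def
  proof eventually_elim
    case (elim t)
    then show ?case
      using holomorphic_power_series[OF r(2), of "of_real t"] by simp
  qed
qed

(* The expansions exist when \<alpha> is a nonnegative integer (any lam) and when lam = -1 (any \<alpha>).  In the
   remaining cases the generating function is asymptotic to a nonzero multiple of t powr \<alpha> as t
   tends to 0 from the right, so it is not the sum of a power series in t. *)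
lemma has_egf_generic:
  fixes a b :: real and \<alpha> lam x :: complex
  assumes ab: "0 < a" "0 < b" "a \<noteq> b" and cases: "\<alpha> \<in> \<nat> \<or> lam = -1"
  shows "\<exists>G. has_egf (\<lambda>t. (2 * of_real t / (lam * of_real (b powr t) + of_real (a powr t))) powr \<alpha>
                             * exp (x * of_real t)) G"
proof -
  define h where "h w = lam * exp (w * of_real (ln b)) + exp (w * of_real (ln a))" for w :: complex
  have h_real: "lam * of_real (b powr t) + of_real (a powr t) = h (of_real t)" for t
    using ab by (simp add: h_def powr_def flip: exp_of_real)
  have h_hol: "h holomorphic_on UNIV" unfolding h_def by (intro holomorphic_intros)
  have "\<exists>g. g analytic_on {0} \<and>
    (\<forall>\<^sub>F t in at 0. (2 * of_real t / h (of_real t)) powr \<alpha> * exp (x * of_real t) = g (complex_of_real t))"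
  proof (cases "lam = -1")
    case True
    define c where "c = ln a - ln b"
    have c: "c \<noteq> 0" using ab by (simp add: c_def)
    have dh: "deriv h 0 = of_real c"
      unfolding h_def[abs_def] True c_def
      by (rule DERIV_imp_deriv) (auto intro!: derivative_eq_intros)
    define q where "q w = (if w = 0 then deriv h 0 else (h w - h 0) / (w - 0))" for w
    have q_hol: "q holomorphic_on UNIV"
      unfolding q_def by (rule pole_lemma_open[OF h_hol]) auto
    have q_ana: "q analytic_on {0}"
      using q_hol by (simp add: analytic_on_holomorphic) blast
    have q0: "q 0 = of_real c" by (simp add: q_def dh)
    define v where "v w = of_real c / q w" for w
    have v_ana: "v analytic_on {0}"
      unfolding v_def by (intro analytic_intros q_ana) (auto simp: q0 c)
    have v0: "v 0 = 1" by (simp add: v_def q0 c)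
    define g where "g w = (of_real (2 / c)) powr \<alpha> * (exp (\<alpha> * Ln (v w)) * exp (x * w))" for w
    have g_ana: "g analytic_on {0}"
      unfolding g_def by (intro analytic_intros v_ana) (auto simp: v0)
    have "isCont v 0" by (rule analytic_at_imp_isCont[OF v_ana])
    then have "((\<lambda>t. v (of_real t)) \<longlongrightarrow> v (of_real 0)) (at (0::real))"
      by (intro isCont_tendsto_compose[of _ v] tendsto_intros) auto
    then have "((\<lambda>t. Re (v (of_real t))) \<longlongrightarrow> 1) (at (0::real))"
      using tendsto_Re[of "\<lambda>t. v (of_real t)" 1] by (simp add: v0)
    then have "\<forall>\<^sub>F t in at (0::real). Re (v (of_real t)) > 0"
      by (rule order_tendstoD) simp
    moreover have "\<forall>\<^sub>F t in at (0::real). t \<noteq> 0" by (simp add: eventually_at_filter)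
    ultimately have "\<forall>\<^sub>F t in at 0. (2 * of_real t / h (of_real t)) powr \<alpha> * exp (x * of_real t)
                        = g (complex_of_real t)"
    proof eventually_elim
      case (elim t)
      have hr: "h (of_real t) = of_real (a powr t - b powr t)"
        using h_real[of t] True by simp
      have qv: "q (of_real t) = h (of_real t) / of_real t"
        using elim by (simp add: q_def h_def True)
      have vr: "v (of_real t) \<in> \<real>" unfolding v_def qv hr by auto
      have vn: "v (of_real t) \<noteq> 0" using elim by auto
      have "2 * of_real t / h (of_real t) = v (of_real t) * of_real (2 / c)"
        using c by (simp add: v_def qv)
      then have "(2 * of_real t / h (of_real t)) powr \<alpha>
          = v (of_real t) powr \<alpha> * of_real (2 / c) powr \<alpha>"
        using powr_times_real_left[OF vr, of "of_real (2 / c)" \<alpha>] elim by (simp del: of_real_divide)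
      then show ?case using vn by (simp add: g_def powr_def)
    qed
    with g_ana show ?thesis by blast
  next
    case False
    then obtain k where k: "\<alpha> = of_nat k" using cases by (auto elim: Nats_cases)
    define g where "g w = (2 * w / h w) ^ k * exp (x * w)" for w
    have h0: "h 0 \<noteq> 0" using False by (simp add: h_def eq_neg_iff_add_eq_0)
    have h_ana: "h analytic_on {0}" using h_hol by (simp add: analytic_on_holomorphic) blast
    have g_ana: "g analytic_on {0}"
      unfolding g_def by (intro analytic_intros h_ana) (auto simp: h0)
    have "isCont h 0" by (rule analytic_at_imp_isCont[OF h_ana])
    then have "((\<lambda>t. h (of_real t)) \<longlongrightarrow> h (of_real 0)) (at (0::real))"
      by (intro isCont_tendsto_compose[of _ h] tendsto_intros) auto
    then have "\<forall>\<^sub>F t in at (0::real). h (of_real t) \<noteq> 0"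
      using h0 by (intro tendsto_imp_eventually_ne) auto
    moreover have "\<forall>\<^sub>F t in at (0::real). t \<noteq> 0" by (simp add: eventually_at_filter)
    ultimately have "\<forall>\<^sub>F t in at 0. (2 * of_real t / h (of_real t)) powr \<alpha> * exp (x * of_real t)
                        = g (complex_of_real t)"
    proof eventually_elim
      case (elim t)
      then show ?case unfolding g_def k by (subst powr_nat') auto
    qed
    with g_ana show ?thesis by blast
  qed
  then obtain g where "g analytic_on {0}"
    "\<forall>\<^sub>F t in at 0. (2 * of_real t / h (of_real t)) powr \<alpha> * exp (x * of_real t) = g (complex_of_real t)"
    by blast
  from has_egf_analytic[OF this] show ?thesis unfolding h_real by blast
qed

lemma apostol_genocchi_number_has_egf:
  assumes "0 < a" "0 < b" "a \<noteq> b" "\<alpha> \<in> \<nat> \<or> lam = -1"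
  shows "has_egf (\<lambda>t. (2 * of_real t / (lam * of_real (b powr t) + of_real (a powr t))) powr \<alpha>)
           (apostol_genocchi_number \<alpha> a b lam)"
  using has_egf_generic[OF assms, of 0] egf_coeff_eq
  unfolding apostol_genocchi_number_def by fastforce

lemma apostol_genocchi_poly_has_egf:
  assumes "\<alpha> \<in> \<nat> \<or> lam = -1"
  shows "has_egf (\<lambda>z. (2 * of_real z / (lam * exp (of_real z) + 1)) powr \<alpha> * exp (x * of_real z))
           (apostol_genocchi_poly \<alpha> x lam)"
proof -
  have "exp (1::real) \<noteq> 1" by simp
  from has_egf_generic[of 1 "exp 1" \<alpha> lam x] assms this
  obtain G where "has_egf (\<lambda>z. (2 * of_real z / (lam * exp (of_real z) + 1)) powr \<alpha>
                               * exp (x * of_real z)) G"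
    by (auto simp: powr_def simp flip: exp_of_real)
  then show ?thesis using egf_coeff_eq unfolding apostol_genocchi_poly_def by fastforce
qed

end

theory Submission
  imports Defs
begin

text \<open>
  Put \<open>c = ln b - ln a\<close> and \<open>z = c t\<close>. Pulling the positive factor \<open>a powr t\<close> out of the power
  turns the generating function of the numbers into \<open>c powr (-\<alpha>)\<close> times that of the polynomials
  at \<open>z\<close>. For negative \<open>c\<close> splitting off \<open>c powr (-\<alpha>)\<close> respects the principal branch if \<open>\<alpha>\<close> is
  a nonnegative integer, or if \<open>lam = -1\<close>, as \<open>2 z / (1 - exp z)\<close> is then a negative real.
  In the remaining cases both generating functions behave like \<open>t powr \<alpha>\<close> as \<open>t\<close> tends to \<open>0\<close>
  from the right, so neither has an expansion and both sides of the identity are \<open>0\<close>.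
\<close>

section \<open>Transport of expansions\<close>

lemma has_egf_cong:
  assumes "has_egf g G" and "\<forall>\<^sub>F t in at 0. f t = g t"
  shows "has_egf f G"
  using assms unfolding has_egf_def by eventually_elim simp

lemma has_egf_scale:
  assumes "has_egf f G" and "c \<noteq> 0"
  shows "has_egf (\<lambda>t. k * f (c * t)) (\<lambda>n. k * (of_real c ^ n * G n))"
proof -
  have "((\<lambda>t. c * t) \<longlongrightarrow> c * 0) (at 0)"
    by (intro tendsto_intros)
  \<comment> \<open>\<open>has_egf\<close> only sees punctured neighbourhoods of 0, so the
    substitution must avoid 0 too.\<close>
  moreover have "\<forall>\<^sub>F t in at 0. c * t \<noteq> 0"
    using \<open>c \<noteq> 0\<close> by (simp add: eventually_at_filter)
  ultimately have "filterlim (\<lambda>t. c * t) (at 0) (at 0)"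
    by (simp add: filterlim_at)
  then have "\<forall>\<^sub>F t in at 0. (\<lambda>n. G n * of_real (c * t) ^ n / fact n) sums f (c * t)"
    using assms(1) unfolding has_egf_def by (rule eventually_compose_filterlim[rotated])
  then show ?thesis
    unfolding has_egf_def
  proof eventually_elim
    case (elim t)
    from sums_mult[OF this, of k] show ?case
      by (simp add: power_mult_distrib mult_ac)
  qed
qed

section \<open>Non-existence of expansions\<close>

text \<open>Replacing \<open>t\<close> by \<open>exp s * t\<close> keeps the limit but multiplies
  the power by \<open>exp (\<beta> * s)\<close>. This factor is therefore 1 for all real
  \<open>s\<close>, and its derivative at \<open>s = 0\<close> is \<beta>.\<close>

lemma of_real_powr_tendsto_imp_zero:
  fixes \<beta> M :: complex
  assumes lim: "((\<lambda>t. of_real t powr \<beta>) \<longlongrightarrow> M) (at_right (0::real))" and "M \<noteq> 0"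
  shows "\<beta> = 0"
proof -
  have one: "exp (\<beta> * of_real s) = 1" for s :: real
  proof -
    have pos: "\<forall>\<^sub>F t in at_right (0::real). t > 0"
      by (simp add: eventually_at_right_less)
    have "((\<lambda>t. exp s * t) \<longlongrightarrow> exp s * 0) (at_right 0)"
      by (intro tendsto_intros)
    then have "filterlim (\<lambda>t. exp s * t) (at_right 0) (at_right 0)"
      using pos by (auto simp: filterlim_at elim: eventually_mono)
    from filterlim_compose[OF lim this]
    have "((\<lambda>t. of_real (exp s * t) powr \<beta>) \<longlongrightarrow> M) (at_right (0::real))" .
    from tendsto_divide[OF this lim \<open>M \<noteq> 0\<close>]
    have "((\<lambda>t. of_real (exp s * t) powr \<beta> / of_real t powr \<beta>) \<longlongrightarrow> 1) (at_right (0::real))"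
      using \<open>M \<noteq> 0\<close> by simp
    moreover have "\<forall>\<^sub>F t in at_right (0::real).
        of_real (exp s * t) powr \<beta> / of_real t powr \<beta> = exp (\<beta> * of_real s)"
      using pos
    proof eventually_elim
      case (elim t)
      \<comment> \<open>Both factors are positive reals, so the logarithm is additive without a
        multiple of \<open>2 * pi * \<i>\<close>.\<close>
      then have "Ln (of_real (exp s * t)) = of_real s + Ln (of_real t)"
        by (subst Ln_of_real) (auto simp: ln_mult Ln_of_real)
      with elim show ?case
        by (simp add: powr_def exp_add[symmetric] exp_diff[symmetric] algebra_simps del: of_real_mult)
    qed
    ultimately have "((\<lambda>_. exp (\<beta> * of_real s)) \<longlongrightarrow> 1) (at_right (0::real))"
      using tendsto_cong by fastforce
    then show ?thesis
      by (simp add: tendsto_const_iff)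
  qed
  have "((\<lambda>s::real. exp (\<beta> * of_real s)) has_vector_derivative \<beta>) (at 0)"
    by (auto intro!: derivative_eq_intros has_vector_derivative_real_field)
  moreover have "((\<lambda>s::real. exp (\<beta> * of_real s)) has_vector_derivative 0) (at 0)"
    unfolding one by simp
  ultimately show ?thesis
    by (rule vector_derivative_unique_at)
qed

text \<open>If \<open>m\<close> is the index of the first nonzero coefficient, then
  \<open>f t / t ^ m\<close> has a nonzero limit. Hence so does
  \<open>t powr (\<alpha> - m)\<close>, which forces \<open>\<alpha> = m\<close>.\<close>

lemma has_egf_powr_asymp_imp_Nats:
  fixes \<alpha> L :: complex
  assumes egf: "has_egf f G"
    and f: "\<forall>\<^sub>F t in at_right 0. f t = of_real t powr \<alpha> * g t"
    and g: "(g \<longlongrightarrow> L) (at_right (0::real))" and "L \<noteq> 0"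
  shows "\<alpha> \<in> \<nat>"
proof -
  have pos: "\<forall>\<^sub>F t in at_right (0::real). t > 0"
    by (simp add: eventually_at_right_less)
  have gn: "\<forall>\<^sub>F t in at_right 0. g t \<noteq> 0"
    using g \<open>L \<noteq> 0\<close> by (rule tendsto_imp_eventually_ne)
  have ser: "\<forall>\<^sub>F t in at_right 0. (\<lambda>n. G n * of_real t ^ n / fact n) sums f t"
    using egf unfolding has_egf_def by (simp add: eventually_at_split)
  \<comment> \<open>Otherwise \<open>f\<close> would vanish near 0, whereas
    \<open>t powr \<alpha> * g t\<close> is nonzero for small positive \<open>t\<close>.\<close>
  have "\<exists>n. G n \<noteq> 0"
  proof (rule ccontr)
    assume "\<not> ?thesis"
    from ser f gn pos have "\<forall>\<^sub>F t in at_right (0::real). False"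
    proof eventually_elim
      case (elim t)
      then show ?case
        using \<open>\<not> (\<exists>n. G n \<noteq> 0)\<close> by (auto simp: sums_iff)
    qed
    then show False
      by simp
  qed
  define m where "m = (LEAST n. G n \<noteq> 0)"
  have Gm: "G m \<noteq> 0" and Gl: "\<And>n. n < m \<Longrightarrow> G n = 0"
    using LeastI_ex[OF \<open>\<exists>n. G n \<noteq> 0\<close>] not_less_Least by (auto simp: m_def)
  define d where "d n = G (n + m) / fact (n + m)" for n
  define u where "u z = (\<Sum>n. d n * z ^ n)" for z
  have d_sums: "(\<lambda>n. d n * of_real t ^ n) sums (f t / of_real t ^ m)"
    if "t > 0" "(\<lambda>n. G n * of_real t ^ n / fact n) sums f t" for t
  proof -
    have "(\<lambda>n. G (n + m) * of_real t ^ (n + m) / fact (n + m)) sums f t"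
      using that(2) Gl sums_zero_iff_shift[of m "\<lambda>n. G n * of_real t ^ n / fact n"] by simp
    from sums_divide[OF this, of "of_real t ^ m"] that(1) show ?thesis
      by (simp add: d_def power_add)
  qed
  have fu: "\<forall>\<^sub>F t in at_right 0. t > 0 \<and> (\<lambda>n. d n * of_real t ^ n) sums (f t / of_real t ^ m)"
    using ser pos by eventually_elim (use d_sums in auto)
  \<comment> \<open>Convergence at a single positive point \<open>r\<close> gives convergence in the
    complex disc of that radius.\<close>
  obtain r where r: "r > 0" "summable (\<lambda>n. d n * of_real r ^ n)"
    using eventually_happens'[OF _ fu] by (auto simp: sums_iff)
  have "(u \<longlongrightarrow> d 0) (at 0)"
  proof (rule powser_limit_0)
    show "r > 0" by fact
    show "(\<lambda>n. d n * z ^ n) sums u z" if "norm z < r" for z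
      using powser_inside[OF r(2), of z] that r(1) by (simp add: u_def summable_sums)
  qed
  moreover have "filterlim complex_of_real (at 0) (at_right 0)"
    using pos by (auto simp: filterlim_at intro!: tendsto_eq_intros elim: eventually_mono)
  ultimately have "((\<lambda>t. u (of_real t)) \<longlongrightarrow> d 0) (at_right 0)"
    by (rule filterlim_compose)
  from tendsto_divide[OF this g \<open>L \<noteq> 0\<close>]
  have "((\<lambda>t. u (of_real t) / g t) \<longlongrightarrow> d 0 / L) (at_right 0)" .
  moreover have "\<forall>\<^sub>F t in at_right 0. u (of_real t) / g t = of_real t powr (\<alpha> - of_nat m)"
    using fu f gn
  proof eventually_elim
    case (elim t)
    then have "u (of_real t) = of_real t powr \<alpha> * g t / of_real t ^ m"
      by (auto simp: u_def sums_iff)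
    with elim show ?case
      by (simp add: powr_diff powr_nat')
  qed
  ultimately have "((\<lambda>t. of_real t powr (\<alpha> - of_nat m)) \<longlongrightarrow> d 0 / L) (at_right (0::real))"
    using tendsto_cong by fastforce
  moreover have "d 0 / L \<noteq> 0"
    using Gm \<open>L \<noteq> 0\<close> by (simp add: d_def)
  ultimately have "\<alpha> - of_nat m = 0"
    by (rule of_real_powr_tendsto_imp_zero)
  then show ?thesis
    by simp
qed

text \<open>The base is \<open>t\<close> times \<open>2 / h t\<close>, whose limit \<open>p\<close>
  is nonzero, and a positive \<open>t\<close> splits off the principal power. The instance
  \<open>x = 0\<close> serves the numbers, \<open>a = 1\<close> and \<open>b = exp 1\<close> the
  polynomials.\<close>

lemma not_has_egf_generic:
  fixes a b :: real and \<alpha> lam x :: complex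
  assumes ab: "0 < a" "0 < b" and "\<alpha> \<notin> \<nat>" and "lam \<noteq> -1"
  shows "\<not> has_egf (\<lambda>t. (2 * of_real t / (lam * of_real (b powr t) + of_real (a powr t))) powr \<alpha>
                       * exp (x * of_real t)) G"
proof
  define h where "h t = lam * of_real (b powr t) + of_real (a powr t)" for t :: real
  define p where "p = 2 / (lam + 1)"
  assume egf: "has_egf (\<lambda>t. (2 * of_real t / (lam * of_real (b powr t) + of_real (a powr t))) powr \<alpha>
                 * exp (x * of_real t)) G"
  have l1: "lam + 1 \<noteq> 0"
    using \<open>lam \<noteq> -1\<close> by (simp add: eq_neg_iff_add_eq_0)
  then have p0: "p \<noteq> 0"
    by (simp add: p_def)
  have "(h \<longlongrightarrow> lam * of_real (b powr 0) + of_real (a powr 0)) (at_right 0)"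
    unfolding h_def using ab by (intro tendsto_intros) auto
  then have h: "(h \<longlongrightarrow> lam + 1) (at_right 0)"
    using ab by simp
  then have q: "((\<lambda>t. 2 / h t) \<longlongrightarrow> p) (at_right 0)"
    unfolding p_def using l1 by (intro tendsto_intros)
  have qn: "\<forall>\<^sub>F t in at_right 0. 2 / h t \<noteq> 0"
    using q p0 by (rule tendsto_imp_eventually_ne)
  have qa: "((\<lambda>t. (2 / h t) powr \<alpha>) \<longlongrightarrow> p powr \<alpha>) (at_right 0)"
  proof (cases "p \<in> \<real>\<^sub>\<le>\<^sub>0")
    case False
    then show ?thesis
      by (intro tendsto_intros q) auto
  next
    case True
    \<comment> \<open>The limit is on the branch cut, but \<open>lam\<close> is real, so \<open>2 / h t\<close> stays on the cut as well.\<close>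
    have "lam = 2 / p - 1"
      using l1 by (simp add: p_def field_simps)
    moreover have "p \<in> \<real>"
      using True nonpos_Reals_subset_Reals by blast
    ultimately have "lam \<in> \<real>"
      by auto
    then have real: "2 / h t \<in> \<real>" for t
      by (auto simp: h_def)
    have "Re p < 0" "Im p = 0"
      using True p0 by (auto simp: complex_nonpos_Reals_iff complex_eq_iff)
    have "\<forall>\<^sub>F t in at_right 0. Re (2 / h t) < 0"
      using tendsto_Re[OF q] \<open>Re p < 0\<close> by (rule order_tendstoD)
    \<comment> \<open>Splitting off \<open>-1\<close> moves the limit to the positive number
      \<open>-p\<close>, where the principal power is continuous.\<close>
    then have "\<forall>\<^sub>F t in at_right 0. (- (2 / h t)) powr \<alpha> * (-1) powr \<alpha> = (2 / h t) powr \<alpha>"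
    proof eventually_elim
      case (elim t)
      then show ?case
        using powr_times_real_left[of "- (2 / h t)" "-1" \<alpha>] real[of t] by auto
    qed
    moreover have "((\<lambda>t. (- (2 / h t)) powr \<alpha> * (-1) powr \<alpha>) \<longlongrightarrow> (-p) powr \<alpha> * (-1) powr \<alpha>) (at_right 0)"
      using \<open>Re p < 0\<close> q by (intro tendsto_intros) (auto simp: complex_nonpos_Reals_iff)
    moreover have "(-p) powr \<alpha> * (-1) powr \<alpha> = p powr \<alpha>"
      using powr_times_real_left[of "-p" "-1" \<alpha>] \<open>p \<in> \<real>\<close> \<open>Re p < 0\<close> by auto
    ultimately show ?thesis
      using tendsto_cong by fastforce
  qed
  have "((\<lambda>t. (2 / h t) powr \<alpha> * exp (x * of_real t)) \<longlongrightarrow> p powr \<alpha> * exp (x * of_real 0)) (at_right 0)"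
    by (intro tendsto_mult[OF qa] tendsto_intros)
  moreover have "p powr \<alpha> * exp (x * of_real 0) \<noteq> 0"
    using p0 by simp
  moreover have "\<forall>\<^sub>F t in at_right 0. (2 * of_real t / h t) powr \<alpha> * exp (x * of_real t)
      = of_real t powr \<alpha> * ((2 / h t) powr \<alpha> * exp (x * of_real t))"
    using eventually_at_right_less[of 0]
  proof eventually_elim
    case (elim t)
    then show ?case
      using powr_times_real_left[of "of_real t" "2 / h t" \<alpha>] by (simp add: mult_ac)
  qed
  ultimately have "\<alpha> \<in> \<nat>"
    using has_egf_powr_asymp_imp_Nats[OF egf[folded h_def],
        of \<alpha> "\<lambda>t. (2 / h t) powr \<alpha> * exp (x * of_real t)"] by blast
  with \<open>\<alpha> \<notin> \<nat>\<close> show False ..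
qed

section \<open>Comparison of the two generating functions\<close>

text \<open>The principal power is multiplicative as soon as one factor is a nonnegative real: this
  is \<open>c\<close> if \<open>c > 0\<close>, and the quotient if \<open>c < 0\<close> and
  \<open>lam = -1\<close>. For natural \<alpha> the powers are ordinary ones.\<close>

lemma genocchi_base_powr_scale:
  fixes c t :: real and \<alpha> lam :: complex
  assumes "c \<noteq> 0" and "t \<noteq> 0" and "\<alpha> \<in> \<nat> \<or> lam = -1"
    and nz: "2 * of_real t / (lam * exp (of_real (c * t)) + 1) \<noteq> 0"
  shows "(2 * of_real (c * t) / (lam * exp (of_real (c * t)) + 1)) powr \<alpha>
       = of_real c powr \<alpha> * (2 * of_real t / (lam * exp (of_real (c * t)) + 1)) powr \<alpha>"
proof -
  define r where "r = 2 * of_real t / (lam * exp (of_real (c * t)) + 1)"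
  have split: "2 * of_real (c * t) / (lam * exp (of_real (c * t)) + 1) = of_real c * r"
    by (simp add: r_def)
  have "(of_real c * r) powr \<alpha> = of_real c powr \<alpha> * r powr \<alpha>"
  proof (cases "c > 0")
    case True
    then show ?thesis
      using powr_times_real_left[of "of_real c" r \<alpha>] by simp
  next
    case False
    with \<open>c \<noteq> 0\<close> have c: "c < 0" by simp
    from assms(3) show ?thesis
    proof
      assume "\<alpha> \<in> \<nat>"
      then obtain k where "\<alpha> = of_nat k" by (auto elim: Nats_cases)
      then show ?thesis
        using nz[folded r_def] \<open>c \<noteq> 0\<close> by (simp add: powr_nat' power_mult_distrib)
    next
      assume "lam = -1"
      then have r: "r = of_real (2 * t / (1 - exp (c * t)))"
        by (simp add: r_def flip: exp_of_real)
      \<comment> \<open>As \<open>c < 0\<close>, numerator and denominator have the same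
        sign.\<close>
      have "2 * t / (1 - exp (c * t)) \<ge> 0"
        using c \<open>t \<noteq> 0\<close> by (cases "t > 0") (auto simp: zero_le_divide_iff mult_le_0_iff zero_le_mult_iff)
      then show ?thesis
        using powr_times_real_left[of r "of_real c" \<alpha>] by (simp add: r mult_ac del: of_real_divide)
    qed
  qed
  then show ?thesis
    unfolding split by (simp add: r_def)
qed

theorem theorem3p1:
  fixes a b :: real and n :: nat and \<alpha> lam :: complex
  assumes "0 < a" and "0 < b" and "a \<noteq> b"
  shows "apostol_genocchi_number \<alpha> a b lam n =
           apostol_genocchi_poly \<alpha> (\<alpha> * of_real (ln a) / of_real (ln a - ln b)) lam n *
           of_real (ln b - ln a) powr (of_nat n - \<alpha>)"
proof (cases "\<alpha> \<in> \<nat> \<or> lam = -1")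
  case False
  \<comment> \<open>Without an expansion \<open>egf_coeff\<close> takes its default value 0.\<close>
  have "apostol_genocchi_number \<alpha> a b lam n = 0"
    using not_has_egf_generic[of a b \<alpha> lam 0] False assms
    by (simp add: apostol_genocchi_number_def egf_coeff_def)
  moreover have "apostol_genocchi_poly \<alpha> x lam n = 0" for x
    using not_has_egf_generic[of 1 "exp 1" \<alpha> lam x] False
    by (simp add: apostol_genocchi_poly_def egf_coeff_def powr_def flip: exp_of_real)
  ultimately show ?thesis
    by simp
next
  case True
  define c where "c = ln b - ln a"
  define x where "x = \<alpha> * of_real (ln a) / of_real (ln a - ln b)"
  have c: "c \<noteq> 0"
    using assms by (simp add: c_def)
  \<comment> \<open>This choice of \<open>x\<close> makes \<open>exp (x * c * t)\<close> equal to
    the factor \<open>(a powr (-t)) powr \<alpha>\<close> that is split off below.\<close>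
  have xc: "x * of_real c = - (\<alpha> * of_real (ln a))"
  proof -
    have "of_real (ln a - ln b) = - complex_of_real c"
      by (simp add: c_def)
    then show ?thesis
      using c unfolding x_def by simp
  qed
  define N where "N t = 2 * of_real t / (lam * of_real (b powr t) + of_real (a powr t))" for t
  define P where "P z = (2 * of_real z / (lam * exp (of_real z) + 1)) powr \<alpha> * exp (x * of_real z)" for z
  have "has_egf P (apostol_genocchi_poly \<alpha> x lam)"
    unfolding P_def by (rule apostol_genocchi_poly_has_egf[OF True])
  from has_egf_scale[OF this c, of "of_real c powr (-\<alpha>)"]
  have "has_egf (\<lambda>t. of_real c powr (-\<alpha>) * P (c * t))
          (\<lambda>k. of_real c powr (-\<alpha>) * (of_real c ^ k * apostol_genocchi_poly \<alpha> x lam k))" .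
  moreover have "\<forall>\<^sub>F t in at 0. N t powr \<alpha> = of_real c powr (-\<alpha>) * P (c * t)"
    using eventually_neq_at_within[of 0]
  proof eventually_elim
    case (elim t)
    define r where "r = 2 * of_real t / (lam * exp (of_real (c * t)) + 1)"
    have bt: "b powr t = a powr t * exp (c * t)"
      using assms by (simp add: powr_def c_def algebra_simps flip: exp_add)
    have "N t = of_real (a powr (-t)) * r"
      using assms by (simp add: N_def r_def bt exp_of_real powr_minus field_simps flip: of_real_mult)
    then have "N t powr \<alpha> = of_real (a powr (-t)) powr \<alpha> * r powr \<alpha>"
      using powr_times_real_left[of "of_real (a powr (-t))" r \<alpha>] by simp
    also have "of_real (a powr (-t)) powr \<alpha> = exp (x * of_real c * of_real t)"
      using assms unfolding xc by (simp add: powr_def Ln_of_real mult_ac)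
    \<comment> \<open>Inserting \<open>c powr (-\<alpha>) * c powr \<alpha> = 1\<close> lets the
      second factor turn \<open>t\<close> into \<open>c * t\<close> in the numerator.\<close>
    also have "r powr \<alpha> = of_real c powr (-\<alpha>) * (of_real c powr \<alpha> * r powr \<alpha>)"
      using c by (simp add: powr_minus)
    also have "of_real c powr \<alpha> * r powr \<alpha> = (2 * of_real (c * t) / (lam * exp (of_real (c * t)) + 1)) powr \<alpha>"
    \<comment> \<open>As \<open>t\<close> is nonzero, \<open>r = 0\<close> means a vanishing
      denominator; division by zero then makes both bases 0.\<close>
    proof (cases "r = 0")
      case True
      then show ?thesis
        using elim by (auto simp: r_def)
    next
      case False
      then show ?thesis
        using genocchi_base_powr_scale[OF c elim True] unfolding r_def by simp
    qed
    finally show ?case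
      by (simp add: P_def mult_ac)
  qed
  ultimately have "has_egf (\<lambda>t. N t powr \<alpha>)
      (\<lambda>k. of_real c powr (-\<alpha>) * (of_real c ^ k * apostol_genocchi_poly \<alpha> x lam k))"
    by (rule has_egf_cong)
  \<comment> \<open>Uniqueness of the expansion identifies these coefficients with the
    numbers.\<close>
  from egf_coeff_eq[OF this]
  have "apostol_genocchi_number \<alpha> a b lam n
      = of_real c powr (-\<alpha>) * (of_real c ^ n * apostol_genocchi_poly \<alpha> x lam n)"
    by (simp add: apostol_genocchi_number_def N_def)
  moreover have "of_real c powr (of_nat n - \<alpha>) = of_real c ^ n * of_real c powr (-\<alpha>)"
    using c by (simp add: powr_diff powr_minus powr_nat' field_simps)
  ultimately show ?thesis
    by (simp add: c_def x_def)
qed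

end
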